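(* Let $(\mathcal{M},+,0)$ be a commutative monoid and let $S=(s_i)_{i\geq 1}$ be a sequence of elements of $\mathcal{M}$. Let $\Phi_S$ be the map sending an over-partition $\lambda\in\overline{\mathcal{P}}$ to the sequence $(\mu_i)_{i\geq 1}$ of colored parts such that, for all $i\geq 1$, $\mu_i$ has size $S_{\tilde{\lambda}_i}$ and color $c_{\tilde{\lambda}_i}$, where $\tilde\lambda$ is the conjugate of $\lambda$. Then for all $\lambda\in\overline{\mathcal{P}}$ $$|\Phi_S(\lambda)|=|\lambda|_S\quad\text{and}\quad C(\Phi_S(\lambda))=C(\lambda).$$ Moreover, $\Phi_S$ describes a bijection from $\overline{\mathcal{P}}$ to $\overline{\mathcal{P}}_{\mathcal{C}}^S$, from $\mathcal{P}$ to $\mathcal{P}_{\mathcal{C}}^S$, from $\overline{\mathcal{F}}$ to $\overline{\mathcal{D}}_{\mathcal{C}}^S$, and from $\overline{\mathcal{D}}$ to $\overline{\mathcal{F}}_{\mathcal{C}}^S$, and we have \begin{align*} \sum_{\lambda\in \overline{\mathcal{P}}} C(\lambda) q^{|\lambda|_S} &= \prod_{i\geq 1}\frac{1+c_{\overline{i}}\, q^{S_i}}{1-c_i q^{S_i}},\\ \sum_{\lambda\in \mathcal{P}} C(\lambda) q^{|\lambda|_S} &= \prod_{i\geq 1}\frac{1}{1-c_i q^{S_i}},\\ \sum_{\lambda\in \overline{\mathcal{F}}} C(\lambda) q^{|\lambda|_S} &= \prod_{i\geq 1}(1+c_{\overline{i}}\, q^{S_i}),\\ \sum_{\lambda\in \overline{\mathcal{D}}}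 C(\lambda) q^{|\lambda|_S} &= \sum_{i\geq 1}\ \prod_{1\leq j<i} \frac{c_{\overline{j}}\, q^{S_j}}{1-c_jq^{S_j}}. \end{align*}
   Context: Over-lined integers: $\overline{\mathbb{Z}_{\geq 1}}=\{\overline1,\overline2,\ldots\}$ is a disjoint copy of $\mathbb{Z}_{\ge 1}$; both $i$ and $\overline i$ have size $i$. The set $\mathbb{Z}_{\geq 0}\sqcup\overline{\mathbb{Z}_{\geq 1}}$ is ordered by $0<\overline1<1<\overline2<2<\cdots$. Sums, differences and multiples of such elements are computed with their sizes (so $\overline{j}\cdot s=j\cdot s$). An over-partition is an infinite non-increasing sequence $\lambda=(\lambda_i)_{i\ge1}$ of elements of $\mathbb{Z}_{\geq 0}\sqcup\overline{\mathbb{Z}_{\geq 1}}$ with finitely many nonzero terms, in which each over-lined integer occurs at most once. $\overline{\mathcal P}$ is the set of over-partitions; $\mathcal P\subset\overline{\mathcal P}$ is the set of partitions, i.e. over-partitions without over-lined parts; $\overline{\mathcal D}\subset\overline{\mathcal P}$ is the set of over-partitions all of whose positive parts are over-lined; $\overline{\mathcal F}\subset\overline{\mathcal P}$ is the set of over-partitions $\lambda$ such that $\overline i$ is a part of $\lambda$ for all $\overline i\le\lambda_1$ (equivalently, $\lambda_i-\lambda_{i+1}$ equals $1$ if $\lambda_i$ is over-lined and $0$ otherwise, for all $i\geq 1$). Conjugate: $\tilde\lambda=(\tilde\lambda_i)_{i\ge1}$, where $\tilde\lambda_i$ has size $\#\{j\ge1:\lambda_j\ge\overline i\}$ and is over-lined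 if and only if $\overline i$ is a part of $\lambda$. $S$-weight: $|\lambda|_S=\sum_{i\ge1}\lambda_i\cdot s_i\in\mathcal M$. For $i\in\mathbb{Z}_{\geq 0}\sqcup\overline{\mathbb{Z}_{\geq 1}}$, $S_i=\sum_{0<\overline j\le i}s_j$ (so $S_{\overline i}=S_i=s_1+\cdots+s_i$ and $S_0=0$). Colors: $\mathcal C=\{c_i:i\in\mathbb{Z}_{\ge0}\}\cup\{c_{\overline i}:i\in\mathbb{Z}_{\ge1}\}$ is a set of distinct commuting indeterminates. For $\lambda\in\overline{\mathcal P}$, $C(\lambda)=\prod_{0<\overline i\le\lambda_1}c_{\tilde\lambda_i}$ (equal to $1$ for the zero sequence). A colored part is an element of $\mathcal M$ (its size) together with a color, where the color $c_i$ may only be assigned to the element $S_i$, for $i\in\mathbb{Z}_{\geq 0}\sqcup\overline{\mathbb{Z}_{\geq 1}}$. For $E\subseteq\overline{\mathcal P}$, $E_{\mathcal C}^S$ is the set of sequences $(\lambda_i)_{i\ge1}$ of colored parts such that, if $c_{j_i}$ denotes the color of $\lambda_i$, the sequence $(j_i)_{i\ge1}$ belongs to $E$. For such a colored sequence, $|\lambda|$ is the sum in $\mathcal M$ of the sizes of its parts, and $C(\lambda)$ is the product of the colors of its parts different from the part $0$ with color $c_0$. $q^a$ ($a\in\mathcal M$) are formal powers with $q^aq^b=q^{a+b}$ and $q^0=1$. Identities are between formal power series in the colors with coefficients in the monoid ring of formal powers of $q$. *)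

theory Defs
  imports "HOL-Analysis.Analysis" "HOL-Library.Poly_Mapping"
begin

section \<open>Formal power series in arbitrarily many commuting indeterminates\<close>

text \<open>
  A series in indeterminates indexed by \<open>'v\<close> is an arbitrary family of coefficients indexed by
  the monomials, i.e. by the finitely supported exponent functions \<open>'v \<Rightarrow>\<^sub>0 nat\<close>.
\<close>

typedef ('v, 'a) mfps = "UNIV :: (('v \<Rightarrow>\<^sub>0 nat) \<Rightarrow> 'a) set"
  morphisms mcoeff Abs_mfps
  by simp

setup_lifting type_definition_mfps

lemma mfps_eqI: "(\<And>m. mcoeff f m = mcoeff g m) \<Longrightarrow> f = g"
  by (metis mcoeff_inject ext)

lemma finite_antidiagonal:
  fixes m :: "'v \<Rightarrow>\<^sub>0 nat"
  shows "finite {(a, b). a + b = m}"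
proof -
  let ?B = "insert 0 (\<Union>x\<in>Poly_Mapping.keys m. {..Poly_Mapping.lookup m x})"
  let ?F = "{f. \<forall>x. (x \<in> Poly_Mapping.keys m \<longrightarrow> f x \<in> ?B) \<and> (x \<notin> Poly_Mapping.keys m \<longrightarrow> f x = 0)}"
  have "finite ?F"
    by (rule finite_set_of_finite_funs) auto
  moreover have "Poly_Mapping.lookup ` (fst ` {(a, b). a + b = m}) \<subseteq> ?F"
  proof (intro image_subsetI)
    fix a
    assume "a \<in> fst ` {(a, b). a + b = m}"
    then obtain b where ab: "a + b = m" by auto
    have le: "Poly_Mapping.lookup a x \<le> Poly_Mapping.lookup m x" for x
      by (simp flip: ab add: Poly_Mapping.lookup_add)
    have "Poly_Mapping.lookup a x \<in> ?B" if "x \<in> Poly_Mapping.keys m" for x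
      using that le by blast
    moreover have "Poly_Mapping.lookup a x = 0" if "x \<notin> Poly_Mapping.keys m" for x
      using that le[of x] by (simp add: in_keys_iff)
    ultimately show "Poly_Mapping.lookup a \<in> ?F"
      by simp
  qed
  ultimately have "finite (Poly_Mapping.lookup ` (fst ` {(a, b). a + b = m}))"
    by (rule rev_finite_subset)
  then have "finite (fst ` {(a, b). a + b = m})"
    by (rule finite_imageD) (auto simp: inj_on_def Poly_Mapping.lookup_inject)
  moreover have "inj_on fst {(a, b). a + b = m}"
    by (auto simp: inj_on_def)
  ultimately show ?thesis
    by (rule finite_imageD)
qed

instantiation mfps :: (type, comm_ring_1) comm_ring_1
begin

lift_definition zero_mfps :: "('a, 'b) mfps" is "\<lambda>_. 0" .
lift_definition one_mfps :: "('a, 'b) mfps" is "\<lambda>m. if m = 0 then 1 else 0" .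
lift_definition plus_mfps :: "('a, 'b) mfps \<Rightarrow> ('a, 'b) mfps \<Rightarrow> ('a, 'b) mfps"
  is "\<lambda>f g m. f m + g m" .
lift_definition minus_mfps :: "('a, 'b) mfps \<Rightarrow> ('a, 'b) mfps \<Rightarrow> ('a, 'b) mfps"
  is "\<lambda>f g m. f m - g m" .
lift_definition uminus_mfps :: "('a, 'b) mfps \<Rightarrow> ('a, 'b) mfps"
  is "\<lambda>f m. - f m" .
lift_definition times_mfps :: "('a, 'b) mfps \<Rightarrow> ('a, 'b) mfps \<Rightarrow> ('a, 'b) mfps"
  is "\<lambda>f g m. \<Sum>(a, b) \<in> {(a, b). a + b = m}. f a * g b" .

instance
proof
  fix f g h :: "('a, 'b) mfps"
  show "f + g + h = f + (g + h)"
    by transfer (simp add: add.assoc)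
  show "f + g = g + f"
    by transfer (simp add: add.commute)
  show "0 + f = f"
    by transfer simp
  show "- f + f = 0"
    by transfer simp
  show "f - g = f + - g"
    by transfer simp
  show "(0 :: ('a, 'b) mfps) \<noteq> 1"
    by transfer (metis zero_neq_one)
  show "(f + g) * h = f * h + g * h"
    by transfer (simp add: case_prod_unfold distrib_right sum.distrib)
  show "f * g = g * f"
  proof (transfer, rule ext)
    fix f g :: "('a \<Rightarrow>\<^sub>0 nat) \<Rightarrow> 'b" and m
    show "(\<Sum>(a, b) \<in> {(a, b). a + b = m}. f a * g b) = (\<Sum>(a, b) \<in> {(a, b). a + b = m}. g a * f b)"
      by (rule sum.reindex_bij_witness[of _ prod.swap prod.swap])
        (auto simp: add.commute mult.commute)
  qed
  show "1 * f = f"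
  proof (transfer, rule ext)
    fix f :: "('a \<Rightarrow>\<^sub>0 nat) \<Rightarrow> 'b" and m
    have "(\<Sum>(a, b) \<in> {(a, b). a + b = m}. (if a = 0 then 1 else 0) * f b)
        = (\<Sum>(a, b) \<in> {(0 :: 'a \<Rightarrow>\<^sub>0 nat, m)}. (if a = 0 then 1 else 0) * f b)"
      by (rule sum.mono_neutral_right) (auto simp: finite_antidiagonal split: if_splits)
    then show "(\<Sum>(a, b) \<in> {(a, b). a + b = m}. (if a = 0 then 1 else 0) * f b) = f m"
      by simp
  qed
  show "f * g * h = f * (g * h)"
  proof (transfer, rule ext)
    fix f g h :: "('a \<Rightarrow>\<^sub>0 nat) \<Rightarrow> 'b" and m
    let ?A = "\<lambda>m :: 'a \<Rightarrow>\<^sub>0 nat. {(a, b). a + b = m}"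
    have "(\<Sum>(p, c) \<in> ?A m. (\<Sum>(a, b) \<in> ?A p. f a * g b) * h c)
        = (\<Sum>x \<in> ?A m. \<Sum>y \<in> ?A (fst x). f (fst y) * g (snd y) * h (snd x))"
      by (simp add: case_prod_unfold sum_distrib_right)
    also have "\<dots> = (\<Sum>(x, y) \<in> Sigma (?A m) (\<lambda>x. ?A (fst x)). f (fst y) * g (snd y) * h (snd x))"
      by (rule sum.Sigma) (auto simp: finite_antidiagonal)
    also have "\<dots> = (\<Sum>(x, y) \<in> Sigma (?A m) (\<lambda>x. ?A (snd x)). f (fst x) * (g (fst y) * h (snd y)))"
      by (rule sum.reindex_bij_witness[of _
            "\<lambda>(x, y). ((fst x + fst y, snd y), (fst x, fst y))"
            "\<lambda>(x, y). ((fst y, snd y + snd x), (snd y, snd x))"])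
        (auto simp: add.assoc mult.assoc)
    also have "\<dots> = (\<Sum>x \<in> ?A m. \<Sum>y \<in> ?A (snd x). f (fst x) * (g (fst y) * h (snd y)))"
      by (rule sum.Sigma[symmetric]) (auto simp: finite_antidiagonal)
    also have "\<dots> = (\<Sum>(a, p) \<in> ?A m. f a * (\<Sum>(b, c) \<in> ?A p. g b * h c))"
      by (simp add: case_prod_unfold sum_distrib_left)
    finally show "(\<Sum>(p, c) \<in> ?A m. (\<Sum>(a, b) \<in> ?A p. f a * g b) * h c)
        = (\<Sum>(a, p) \<in> ?A m. f a * (\<Sum>(b, c) \<in> ?A p. g b * h c))" .
  qed
qed

end

text \<open>
  \<open>1 / f\<close> is the inverse in the ring of power series; as usual it is \<open>0\<close> if \<open>f\<close> is not a unit.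
\<close>

instantiation mfps :: (type, comm_ring_1) inverse
begin

definition inverse_mfps :: "('a, 'b) mfps \<Rightarrow> ('a, 'b) mfps" where
  "inverse_mfps f = (if f dvd 1 then THE g. f * g = 1 else 0)"

definition divide_mfps :: "('a, 'b) mfps \<Rightarrow> ('a, 'b) mfps \<Rightarrow> ('a, 'b) mfps" where
  "divide_mfps f g = f * inverse g"

instance ..

end

lemma mfps_inverse_eqI:
  fixes f g :: "('v, 'a::comm_ring_1) mfps"
  assumes "f * g = 1"
  shows "inverse f = g"
proof -
  have "g' = g" if "f * g' = 1" for g'
  proof -
    have "g' = (f * g) * g'"
      by (simp add: assms)
    also have "\<dots> = g * (f * g')"
      by (simp only: ac_simps)
    finally show ?thesis
      by (simp add: that)
  qed
  then have "(THE g. f * g = 1) = g"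
    using assms by (intro the_equality)
  moreover have "f dvd 1"
    using assms by (intro dvdI[of 1 f g]) simp
  ultimately show ?thesis
    by (simp add: inverse_mfps_def)
qed

text \<open>
  The usual topology of formal power series: pointwise convergence of the coefficients, the
  coefficients being discrete. The basic neighbourhoods of \<open>f\<close> fix finitely many coefficients.
\<close>

instantiation mfps :: (type, type) t2_space
begin

definition open_mfps :: "('a, 'b) mfps set \<Rightarrow> bool" where
  "open_mfps U \<longleftrightarrow>
     (\<forall>f\<in>U. \<exists>F. finite F \<and> (\<forall>g. (\<forall>m\<in>F. mcoeff g m = mcoeff f m) \<longrightarrow> g \<in> U))"

instance
proof
  show "open (UNIV :: ('a, 'b) mfps set)"
    unfolding open_mfps_def by blast
next
  fix U V :: "('a, 'b) mfps set"
  assume U: "open U" and V: "open V"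
  show "open (U \<inter> V)"
    unfolding open_mfps_def
  proof
    fix f
    assume f: "f \<in> U \<inter> V"
    obtain F where F: "finite F" "\<forall>g. (\<forall>m\<in>F. mcoeff g m = mcoeff f m) \<longrightarrow> g \<in> U"
      using U f unfolding open_mfps_def by blast
    obtain G where G: "finite G" "\<forall>g. (\<forall>m\<in>G. mcoeff g m = mcoeff f m) \<longrightarrow> g \<in> V"
      using V f unfolding open_mfps_def by blast
    show "\<exists>H. finite H \<and> (\<forall>g. (\<forall>m\<in>H. mcoeff g m = mcoeff f m) \<longrightarrow> g \<in> U \<inter> V)"
      using F G by (intro exI[of _ "F \<union> G"]) auto
  qed
next
  fix K :: "('a, 'b) mfps set set"
  assume K: "\<forall>U\<in>K. open U"
  show "open (\<Union>K)"
    unfolding open_mfps_def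
  proof
    fix f
    assume "f \<in> \<Union>K"
    then obtain U where "U \<in> K" "f \<in> U" by blast
    moreover from this K obtain F
      where "finite F" "\<forall>g. (\<forall>m\<in>F. mcoeff g m = mcoeff f m) \<longrightarrow> g \<in> U"
      unfolding open_mfps_def by blast
    ultimately show "\<exists>F. finite F \<and> (\<forall>g. (\<forall>m\<in>F. mcoeff g m = mcoeff f m) \<longrightarrow> g \<in> \<Union>K)"
      by blast
  qed
next
  fix f g :: "('a, 'b) mfps"
  assume "f \<noteq> g"
  then obtain m where m: "mcoeff f m \<noteq> mcoeff g m"
    using mfps_eqI by blast
  have opn: "open {h :: ('a, 'b) mfps. mcoeff h m = c}" for c
    unfolding open_mfps_def by (auto intro!: exI[of _ "{m}"])
  show "\<exists>U V. open U \<and> open V \<and> f \<in> U \<and> g \<in> V \<and> U \<inter> V = {}"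
    using m opn[of "mcoeff f m"] opn[of "mcoeff g m"]
    by (intro exI[of _ "{h. mcoeff h m = mcoeff f m}"] exI[of _ "{h. mcoeff h m = mcoeff g m}"]) auto
qed

end

lift_definition mfps_const :: "'a \<Rightarrow> ('v, 'a::comm_ring_1) mfps"
  is "\<lambda>r m. if m = 0 then r else 0" .

lift_definition mfps_var :: "'v \<Rightarrow> ('v, 'a::comm_ring_1) mfps"
  is "\<lambda>v m. if m = Poly_Mapping.single v 1 then 1 else 0" .


section \<open>Over-lined integers\<close>

text \<open>
  The disjoint union of the non-negative integers and of a copy of the positive integers:
  \<open>Over k\<close> is the over-lined integer of size \<open>k + 1\<close>, so that there is no over-lined zero.
\<close>

datatype oint = Plain nat | Over nat

text \<open>\<open>bar i\<close> is the over-lined integer of size \<open>i\<close>; meaningful for \<open>i \<ge> 1\<close> only.\<close>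

definition bar :: "nat \<Rightarrow> oint" where
  "bar i = Over (i - 1)"

fun osize :: "oint \<Rightarrow> nat" where
  "osize (Plain n) = n"
| "osize (Over k) = Suc k"

fun overlined :: "oint \<Rightarrow> bool" where
  "overlined (Plain n) = False"
| "overlined (Over k) = True"

text \<open>The position in the chain \<open>Plain 0 < bar 1 < Plain 1 < bar 2 < Plain 2 < \<dots>\<close>.\<close>

fun orank :: "oint \<Rightarrow> nat" where
  "orank (Plain n) = 2 * n"
| "orank (Over k) = 2 * k + 1"

lemma orank_inject: "orank x = orank y \<Longrightarrow> x = y"
  by (cases x; cases y) (auto, presburger+)

instantiation oint :: linorder
begin

definition less_eq_oint :: "oint \<Rightarrow> oint \<Rightarrow> bool" where
  "x \<le> y \<longleftrightarrow> orank x \<le> orank y"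

definition less_oint :: "oint \<Rightarrow> oint \<Rightarrow> bool" where
  "x < y \<longleftrightarrow> orank x < orank y"

instance
  by standard (auto simp: less_eq_oint_def less_oint_def intro: orank_inject)

end


section \<open>Over-partitions\<close>

text \<open>
  All sequences \<open>(x\<^sub>i)\<close> with \<open>i \<ge> 1\<close> (over-partitions, sequences of colored parts, and the sequence
  \<open>S\<close>) are represented by functions \<open>x\<close> on \<open>nat\<close> with \<open>x k\<close> standing for the term of index
  \<open>k + 1\<close>. In particular \<open>Over k\<close> has the size of the index of \<open>x k\<close>.
\<close>

definition overpartitions :: "(nat \<Rightarrow> oint) set" where
  "overpartitions = {l. decseq l \<and> finite {k. l k \<noteq> Plain 0} \<and>
     (\<forall>j k k'. l k = Over j \<longrightarrow> l k' = Over j \<longrightarrow> k = k')}"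

definition partitions :: "(nat \<Rightarrow> oint) set" where
  "partitions = {l \<in> overpartitions. \<forall>k. \<not> overlined (l k)}"

definition overlined_partitions :: "(nat \<Rightarrow> oint) set" where
  "overlined_partitions = {l \<in> overpartitions. \<forall>k. l k > Plain 0 \<longrightarrow> overlined (l k)}"

definition full_overpartitions :: "(nat \<Rightarrow> oint) set" where
  "full_overpartitions = {l \<in> overpartitions. \<forall>j. Over j \<le> l 0 \<longrightarrow> Over j \<in> range l}"

definition conjugate :: "(nat \<Rightarrow> oint) \<Rightarrow> nat \<Rightarrow> oint" where
  "conjugate l k =
     (let n = card {j. l j \<ge> Over k} in if Over k \<in> range l then bar n else Plain n)"

text \<open>
  Both sums over the terms of a sequence are finite for over-partitions. The inner sum is
  the multiple \<open>osize (l k) \<cdot> s k\<close> in the monoid.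
\<close>

definition S_weight :: "(nat \<Rightarrow> 'm::comm_monoid_add) \<Rightarrow> (nat \<Rightarrow> oint) \<Rightarrow> 'm" where
  "S_weight s l = (\<Sum>k\<in>{k. l k \<noteq> Plain 0}. \<Sum>_<osize (l k). s k)"

definition S_sum :: "(nat \<Rightarrow> 'm::comm_monoid_add) \<Rightarrow> oint \<Rightarrow> 'm" where
  "S_sum s i = (\<Sum>k\<in>{k. Over k \<le> i}. s k)"


section \<open>Colors and colored parts\<close>

text \<open>
  The coefficients are the elements of the monoid ring of \<open>'m\<close> over the integers; on
  finitely supported functions, \<open>*\<close> is convolution.
\<close>

type_synonym 'm series = "(oint, 'm \<Rightarrow>\<^sub>0 int) mfps"

definition color :: "oint \<Rightarrow> 'm::comm_monoid_add series" where
  "color i = mfps_var i"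

definition qpow :: "'m::comm_monoid_add \<Rightarrow> 'm series" where
  "qpow a = mfps_const (Poly_Mapping.single a 1)"

definition C_overpartition :: "(nat \<Rightarrow> oint) \<Rightarrow> 'm::comm_monoid_add series" where
  "C_overpartition l = (\<Prod>k\<in>{k. Over k \<le> l 0}. color (conjugate l k))"

text \<open>A colored part \<open>(a, i)\<close> has size \<open>a\<close> and color \<open>c\<^sub>i\<close>.\<close>

type_synonym 'm colored_part = "'m \<times> oint"

definition colored_parts :: "(nat \<Rightarrow> 'm::comm_monoid_add) \<Rightarrow> 'm colored_part set" where
  "colored_parts s = {(a, i). a = S_sum s i}"

definition colored_sequences ::
  "(nat \<Rightarrow> 'm::comm_monoid_add) \<Rightarrow> (nat \<Rightarrow> oint) set \<Rightarrow> (nat \<Rightarrow> 'm colored_part) set" where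
  "colored_sequences s E = {u. range u \<subseteq> colored_parts s \<and> (\<lambda>k. snd (u k)) \<in> E}"

text \<open>\<open>Sum_any\<close> is the sum over the finitely many terms of non-zero size.\<close>

definition colored_size :: "(nat \<Rightarrow> 'm::comm_monoid_add colored_part) \<Rightarrow> 'm" where
  "colored_size u = Sum_any (\<lambda>k. fst (u k))"

definition C_colored :: "(nat \<Rightarrow> 'm::comm_monoid_add colored_part) \<Rightarrow> 'm series" where
  "C_colored u = (\<Prod>k\<in>{k. u k \<noteq> (0, Plain 0)}. color (snd (u k)))"

definition Phi ::
  "(nat \<Rightarrow> 'm::comm_monoid_add) \<Rightarrow> (nat \<Rightarrow> oint) \<Rightarrow> nat \<Rightarrow> 'm colored_part" where
  "Phi s l k = (S_sum s (conjugate l k), conjugate l k)"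

end

theory Submission
  imports Defs
begin

text \<open>
  Writing \<open>\<mu>\<close> for the conjugate of an over-partition \<open>\<lambda>\<close>, conjugation is governed by two symmetric
  relations: \<open>Over i \<le> \<mu> k \<longleftrightarrow> Over k \<le> \<lambda> i\<close> and \<open>\<mu> k = Over i \<longleftrightarrow> \<lambda> i = Over k\<close>. As an element of
  the chain is determined by the over-lined integers below it and by those equal to it, conjugation
  is an involution; the second relation shows that it preserves partitions, and both together that
  it exchanges the two remaining classes. Double counting the pairs \<open>(i, k)\<close> of the first relation
  gives the weight.

  The term of \<open>\<lambda>\<close> is a single monomial recording the multiplicities of the parts of \<open>\<mu>\<close>, with a
  power of \<open>q\<close> as coefficient that is determined by the monomial. Each generating function is thus
  determined by its set of monomials, and such sets are products of local conditions
  on the multiplicities of the two parts of equal size. For the sum over the over-lined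
  partitions, the conditions are truncated at the size of the largest part of \<open>\<mu>\<close>, whence a
  disjoint union in place of a product.
\<close>

section \<open>Conjugation\<close>

text \<open>\<open>Over k\<close> has size \<open>k + 1\<close> and is the smallest element of that
  size in the chain, so comparing with it amounts to comparing sizes.\<close>

lemma Over_le_iff: "Over k \<le> x \<longleftrightarrow> k < osize x"
  by (cases x) (auto simp: less_eq_oint_def)

lemma osize_bar [simp]: "0 < n \<Longrightarrow> osize (bar n) = n"
  by (simp add: bar_def)

lemma osize_eq_0_iff: "osize x = 0 \<longleftrightarrow> x = Plain 0"
  by (cases x) auto

lemma Plain_0_less_iff: "Plain 0 < x \<longleftrightarrow> x \<noteq> Plain 0"
  by (cases x) (auto simp: less_oint_def)

lemma Plain_0_le [simp]: "Plain 0 \<le> x"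
  by (simp add: less_eq_oint_def)

text \<open>The over-lined integers below an element determine its size. Sizes fail to decide the
  order only if they agree while \<open>y\<close> is over-lined and \<open>x\<close> is not; the
  second assumption excludes this.\<close>

lemma oint_leI:
  assumes "\<And>i. Over i \<le> x \<Longrightarrow> Over i \<le> y" and "\<And>i. Over i \<le> x \<Longrightarrow> y = Over i \<Longrightarrow> x = Over i"
  shows "x \<le> y"
proof -
  \<comment> \<open>The largest over-lined integer below a non-zero \<open>x\<close> is
    \<open>Over (osize x - 1)\<close>.\<close>
  have size: "osize x \<le> osize y"
    using assms(1)[of "osize x - 1"] by (cases "osize x") (auto simp: Over_le_iff)
  show ?thesis
  proof (cases x)
    case (Plain n)
    show ?thesis
    proof (cases y)
      case (Over k)
      then have "\<not> Over k \<le> x"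
        using assms(2)[of k] Plain by auto
      then show ?thesis
        using Plain Over by (simp add: Over_le_iff less_eq_oint_def)
    qed (use Plain size in \<open>simp add: less_eq_oint_def\<close>)
  next
    case (Over k)
    then show ?thesis
      using size by (cases y) (auto simp: less_eq_oint_def)
  qed
qed

lemma oint_eqI:
  assumes "\<And>i. Over i \<le> x \<longleftrightarrow> Over i \<le> y" and "\<And>i. x = Over i \<longleftrightarrow> y = Over i"
  shows "x = y"
  by (rule antisym; rule oint_leI) (use assms in auto)

section \<open>Level sets of over-partitions\<close>

lemma overpartition_decseq: "l \<in> overpartitions \<Longrightarrow> i \<le> j \<Longrightarrow> l j \<le> l i"
  by (simp add: overpartitions_def decseq_def)

lemma overpartition_finite: "l \<in> overpartitions \<Longrightarrow> finite {k. l k \<noteq> Plain 0}"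
  by (simp add: overpartitions_def)

lemma overpartition_Over_unique: "l \<in> overpartitions \<Longrightarrow> l k = Over j \<Longrightarrow> l k' = Over j \<Longrightarrow> k = k'"
  unfolding overpartitions_def by blast

lemma finite_Over_le: "l \<in> overpartitions \<Longrightarrow> finite {j. Over k \<le> l j}"
  by (rule finite_subset[OF _ overpartition_finite]) (auto simp: less_eq_oint_def)

text \<open>This turns the cardinalities in the definition of \<open>conjugate\<close> into
  comparisons of indices.\<close>

lemma decseq_level_set:
  fixes A :: "nat set"
  assumes "finite A" "\<And>i j. i \<le> j \<Longrightarrow> j \<in> A \<Longrightarrow> i \<in> A"
  shows "A = {..<card A}"
proof (cases "A = {}")
  case False
  have "A = {..Max A}"
    using assms False by (auto intro: assms(2)[OF _ Max_in])
  then show ?thesis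
    by (metis card_atMost lessThan_Suc_atMost)
qed simp

lemma Over_le_overpartition_iff:
  assumes "l \<in> overpartitions"
  shows "Over k \<le> l i \<longleftrightarrow> i < card {j. Over k \<le> l j}"
proof -
  have "{j. Over k \<le> l j} = {..<card {j. Over k \<le> l j}}"
    by (rule decseq_level_set)
      (use assms finite_Over_le overpartition_decseq order_trans in blast)+
  then show ?thesis
    by blast
qed

section \<open>Conjugation as an involution\<close>

lemma osize_conjugate:
  assumes "l \<in> overpartitions"
  shows "osize (conjugate l k) = card {j. Over k \<le> l j}"
proof (cases "Over k \<in> range l")
  case True
  \<comment> \<open>\<open>bar 0\<close> would have size one, so the level set must be seen to be
    non-empty: it contains the index of the part \<open>Over k\<close>.\<close>
  then have "{j. Over k \<le> l j} \<noteq> {}"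
    by auto
  then show ?thesis
    using True finite_Over_le[OF assms, of k] by (simp add: conjugate_def card_gt_0_iff)
qed (simp add: conjugate_def)

text \<open>Both sides say that \<open>i\<close> is less than the number of parts that are at least
  \<open>Over k\<close>.\<close>

lemma Over_le_conjugate_iff:
  assumes "l \<in> overpartitions"
  shows "Over i \<le> conjugate l k \<longleftrightarrow> Over k \<le> l i"
  by (simp only: Over_le_iff[of i] osize_conjugate[OF assms] Over_le_overpartition_iff[OF assms, symmetric])

lemma overlined_conjugate_iff: "overlined (conjugate l k) \<longleftrightarrow> Over k \<in> range l"
  by (simp add: conjugate_def bar_def Let_def)

text \<open>\<open>Over k\<close> is the smallest value counted by \<open>conjugate l k\<close> and
  occurs at most once, so if it occurs, then at the last counted index.\<close>

lemma conjugate_eq_Over_iff: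
  assumes l: "l \<in> overpartitions"
  shows "conjugate l k = Over i \<longleftrightarrow> l i = Over k"
proof -
  \<comment> \<open>The index \<open>i'\<close> is counted, so it is at most \<open>i\<close>; the
    part at \<open>i\<close> is then squeezed between \<open>Over k\<close> and
    \<open>l i' = Over k\<close>.\<close>
  have *: "i = i'" if "l i' = Over k" "conjugate l k = Over i" for i i'
  proof -
    have "i' \<le> i"
      using that Over_le_conjugate_iff[OF l, of i' k] by (simp add: less_eq_oint_def)
    moreover have "Over k \<le> l i"
      using that Over_le_conjugate_iff[OF l, of i k] by simp
    ultimately have "l i = Over k"
      using overpartition_decseq[OF l, of i' i] that by simp
    then show ?thesis
      using overpartition_Over_unique[OF l] that by blast
  qed
  have over: "(\<exists>i. conjugate l k = Over i) \<longleftrightarrow> (\<exists>i. l i = Over k)"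
    using overlined_conjugate_iff[of l k] by (cases "conjugate l k") (auto, metis rangeI)
  show ?thesis
    using * over by metis
qed

lemma conjugate_neq_0_iff:
  assumes "l \<in> overpartitions"
  shows "conjugate l k \<noteq> Plain 0 \<longleftrightarrow> Over k \<le> l 0"
  using Over_le_conjugate_iff[OF assms, of 0 k] by (simp add: Over_le_iff flip: osize_eq_0_iff)

lemma conjugate_overpartition:
  assumes l: "l \<in> overpartitions"
  shows "conjugate l \<in> overpartitions"
proof -
  have "decseq (conjugate l)"
    unfolding decseq_def
  proof (intro allI impI, rule oint_leI)
    fix k k' i :: nat
    assume k: "k \<le> k'" and *: "Over i \<le> conjugate l k'"
    have "Over k \<le> Over k'"
      using k by (simp add: less_eq_oint_def)
    moreover have k': "Over k' \<le> l i"
      using * by (simp add: Over_le_conjugate_iff[OF l])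
    ultimately show "Over i \<le> conjugate l k"
      by (simp add: Over_le_conjugate_iff[OF l])
    \<comment> \<open>This is the exceptional case of \<open>oint_leI\<close>:
      \<open>Over k'\<close> lies below \<open>l i = Over k\<close>, which together with
      \<open>k \<le> k'\<close> forces equal indices.\<close>
    assume "conjugate l k = Over i"
    then have "l i = Over k"
      by (simp add: conjugate_eq_Over_iff[OF l])
    with k k' have "k = k'"
      by (simp add: less_eq_oint_def)
    then show "conjugate l k' = Over i"
      using \<open>conjugate l k = Over i\<close> by simp
  qed
  moreover have "finite {k. conjugate l k \<noteq> Plain 0}"
    by (simp add: conjugate_neq_0_iff[OF l] Over_le_iff)
  ultimately show ?thesis
    by (auto simp: overpartitions_def conjugate_eq_Over_iff[OF l])
qed

lemma conjugate_conjugate: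
  assumes l: "l \<in> overpartitions"
  shows "conjugate (conjugate l) = l"
proof
  fix k
  show "conjugate (conjugate l) k = l k"
    by (rule oint_eqI)
      (simp_all add: Over_le_conjugate_iff conjugate_eq_Over_iff conjugate_overpartition l)
qed

lemma overlined_iff: "overlined x \<longleftrightarrow> (\<exists>j. x = Over j)"
  by (cases x) auto

section \<open>Conjugation and \<open>Phi\<close> on the classes of over-partitions\<close>

lemma conjugate_partition_iff:
  assumes "l \<in> overpartitions"
  shows "conjugate l \<in> partitions \<longleftrightarrow> l \<in> partitions"
  using assms by (auto simp: partitions_def conjugate_overpartition overlined_iff conjugate_eq_Over_iff)

text \<open>The non-zero terms of the conjugate are those at \<open>k\<close> with
  \<open>Over k \<le> l 0\<close>, and such a term is over-lined exactly if \<open>Over k\<close>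
  occurs in \<open>l\<close>. The two defining conditions thus coincide.\<close>

lemma conjugate_overlined_iff_full:
  assumes l: "l \<in> overpartitions"
  shows "conjugate l \<in> overlined_partitions \<longleftrightarrow> l \<in> full_overpartitions"
proof -
  have "conjugate l k > Plain 0 \<longleftrightarrow> Over k \<le> l 0" for k
    by (simp add: conjugate_neq_0_iff[OF l] Plain_0_less_iff)
  then show ?thesis
    using l by (simp add: overlined_partitions_def full_overpartitions_def
        conjugate_overpartition overlined_conjugate_iff)
qed

lemma conjugate_full_iff_overlined:
  assumes "l \<in> overpartitions"
  shows "conjugate l \<in> full_overpartitions \<longleftrightarrow> l \<in> overlined_partitions"
  using conjugate_overlined_iff_full[OF conjugate_overpartition[OF assms]]
  by (simp add: conjugate_conjugate[OF assms])

text \<open>Conjugation is its own inverse, so an equivalence of memberships suffices for a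
  bijection.\<close>

lemma bij_betw_conjugate:
  assumes "E \<subseteq> overpartitions" "E' \<subseteq> overpartitions"
    and "\<And>l. l \<in> overpartitions \<Longrightarrow> conjugate l \<in> E' \<longleftrightarrow> l \<in> E"
  shows "bij_betw conjugate E E'"
proof (rule bij_betwI[where g = conjugate])
  show "conjugate \<in> E \<rightarrow> E'"
    using assms by blast
  show "conjugate \<in> E' \<rightarrow> E"
  proof
    fix l assume "l \<in> E'"
    then show "conjugate l \<in> E"
      using assms(2) assms(3)[of "conjugate l"] by (auto simp: conjugate_overpartition conjugate_conjugate)
  qed
  show "conjugate (conjugate l) = l" if "l \<in> E" for l
    using assms(1) that by (intro conjugate_conjugate) auto
  show "conjugate (conjugate l) = l" if "l \<in> E'" for l
    using assms(2) that by (intro conjugate_conjugate) auto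
qed

text \<open>The colors dictate the sizes, so attaching the sizes is a bijection whose inverse
  forgets them; \<open>Phi\<close> is conjugation followed by this map.\<close>

lemma bij_betw_Phi:
  assumes "bij_betw conjugate E E'"
  shows "bij_betw (Phi s) E (colored_sequences s E')"
proof -
  have "bij_betw (\<lambda>u k. (S_sum s (u k), u k)) E' (colored_sequences s E')"
  proof (rule bij_betwI[where g = "\<lambda>u k. snd (u k)"])
    show "(\<lambda>u k. (S_sum s (u k), u k)) \<in> E' \<rightarrow> colored_sequences s E'"
      by (auto simp: colored_sequences_def colored_parts_def)
    show "(\<lambda>u k. snd (u k)) \<in> colored_sequences s E' \<rightarrow> E'"
      by (auto simp: colored_sequences_def)
    show "(\<lambda>k. (S_sum s (snd (u k)), snd (u k))) = u" if "u \<in> colored_sequences s E'" for u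
    proof
      fix k
      have "u k \<in> colored_parts s"
        using that by (auto simp: colored_sequences_def)
      then show "(S_sum s (snd (u k)), snd (u k)) = u k"
        by (auto simp: colored_parts_def)
    qed
  qed simp
  from bij_betw_trans[OF assms this] show ?thesis
    by (simp add: comp_def Phi_def[abs_def])
qed

section \<open>Preservation of weight and colors\<close>

lemma S_sum_altdef: "S_sum s i = (\<Sum>k<osize i. s k)"
  by (simp add: S_sum_def Over_le_iff lessThan_def)

text \<open>The pairs \<open>(k, j)\<close> with \<open>Over j \<le> l k\<close>, each contributing
  \<open>s k\<close>, are summed in both orders: fixing \<open>k\<close> gives a multiple of
  \<open>s k\<close>, fixing \<open>j\<close> a partial sum of \<open>s\<close>.\<close>

lemma S_weight_conjugate:
  assumes l: "l \<in> overpartitions"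
  shows "S_weight s l = (\<Sum>k\<in>{k. conjugate l k \<noteq> Plain 0}. S_sum s (conjugate l k))"
proof -
  let ?A = "{k. l k \<noteq> Plain 0}" and ?B = "{k. conjugate l k \<noteq> Plain 0}"
  have fin: "finite ?A" "finite ?B"
    using overpartition_finite conjugate_overpartition l by blast+
  have "S_weight s l = (\<Sum>k\<in>?A. \<Sum>j\<in>{j \<in> ?B. Over j \<le> l k}. s k)"
    unfolding S_weight_def
  proof (rule sum.cong)
    fix k
    \<comment> \<open>The restriction to \<open>?B\<close> loses nothing, because
      \<open>Over j \<le> l k\<close> implies \<open>Over j \<le> l 0\<close>.\<close>
    have "{j \<in> ?B. Over j \<le> l k} = {..<osize (l k)}"
      using overpartition_decseq[OF l, of 0 k]
      by (auto simp: conjugate_neq_0_iff[OF l] simp flip: Over_le_iff)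
    then show "(\<Sum>_<osize (l k). s k) = (\<Sum>j\<in>{j \<in> ?B. Over j \<le> l k}. s k)"
      by simp
  qed simp
  also have "\<dots> = (\<Sum>j\<in>?B. \<Sum>k\<in>{k \<in> ?A. Over j \<le> l k}. s k)"
    by (rule sum.swap_restrict) (use fin in auto)
  also have "\<dots> = (\<Sum>j\<in>?B. S_sum s (conjugate l j))"
  proof (rule sum.cong)
    fix j
    have "{k \<in> ?A. Over j \<le> l k} = {k. Over k \<le> conjugate l j}"
      unfolding Over_le_conjugate_iff[OF l] by (auto simp: Over_le_iff)
    then show "(\<Sum>k\<in>{k \<in> ?A. Over j \<le> l k}. s k) = S_sum s (conjugate l j)"
      by (simp add: S_sum_def)
  qed simp
  finally show ?thesis .
qed

lemma colored_size_Phi: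
  assumes l: "l \<in> overpartitions"
  shows "colored_size (Phi s l) = S_weight s l"
proof -
  have "colored_size (Phi s l) = (\<Sum>k\<in>{k. conjugate l k \<noteq> Plain 0}. S_sum s (conjugate l k))"
    unfolding colored_size_def Phi_def fst_conv
    \<comment> \<open>\<open>Sum_any\<close> sees only terms of non-zero size. These may be fewer
      than the non-zero terms of the conjugate, as partial sums of \<open>s\<close> can vanish in
      the monoid.\<close>
    by (rule Sum_any.expand_superset)
      (use overpartition_finite conjugate_overpartition l in \<open>auto simp: S_sum_altdef\<close>)
  then show ?thesis
    by (simp add: S_weight_conjugate l)
qed

lemma C_overpartition_conjugate:
  assumes "l \<in> overpartitions"
  shows "C_overpartition l = (\<Prod>k\<in>{k. conjugate l k \<noteq> Plain 0}. color (conjugate l k))"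
  by (simp add: C_overpartition_def conjugate_neq_0_iff[OF assms])

lemma C_colored_Phi:
  assumes "l \<in> overpartitions"
  shows "C_colored (Phi s l) = C_overpartition l"
proof -
  have "Phi s l k = (0, Plain 0) \<longleftrightarrow> conjugate l k = Plain 0" for k
    by (auto simp: Phi_def S_sum_altdef)
  then show ?thesis
    by (simp add: C_colored_def C_overpartition_conjugate[OF assms] Phi_def)
qed

section \<open>Series with prescribed support\<close>

lemma mcoeff_mult: "mcoeff (f * g) m = (\<Sum>(a, b)\<in>{(a, b). a + b = m}. mcoeff f a * mcoeff g b)"
  by (simp add: times_mfps.rep_eq)

lemma mcoeff_sum: "mcoeff (sum f A) m = (\<Sum>i\<in>A. mcoeff (f i) m)"
  by (induction A rule: infinite_finite_induct) (simp_all add: zero_mfps.rep_eq plus_mfps.rep_eq)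

lemma mcoeff_mult_const:
  fixes f :: "('v, 'a::comm_ring_1) mfps"
  shows "mcoeff (f * mfps_const c) m = mcoeff f m * c"
proof -
  have "mcoeff (f * mfps_const c) m = (\<Sum>(a, b)\<in>{(m, 0 :: 'v \<Rightarrow>\<^sub>0 nat)}. mcoeff f a * mcoeff (mfps_const c) b)"
    unfolding mcoeff_mult
    by (rule sum.mono_neutral_right) (auto simp: finite_antidiagonal mfps_const.rep_eq split: if_splits)
  then show ?thesis
    by (simp add: mfps_const.rep_eq)
qed

text \<open>A basic neighbourhood fixes finitely many coefficients, so finitely many eventual
  equalities are combined.\<close>

lemma tendsto_mfpsI:
  assumes "\<And>m. eventually (\<lambda>x. mcoeff (f x) m = mcoeff g m) F"
  shows "(f \<longlongrightarrow> g) F"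
proof (rule topological_tendstoI)
  fix U assume "open U" "g \<in> U"
  then obtain M where "finite M" and M: "\<And>h. \<forall>m\<in>M. mcoeff h m = mcoeff g m \<Longrightarrow> h \<in> U"
    unfolding open_mfps_def by blast
  then have "eventually (\<lambda>x. \<forall>m\<in>M. mcoeff (f x) m = mcoeff g m) F"
    using assms by (simp add: eventually_ball_finite)
  then show "eventually (\<lambda>x. f x \<in> U) F"
    by eventually_elim (rule M)
qed

text \<open>The exponent of \<open>q\<close> that a monomial carries if each indeterminate
  \<open>v\<close> carries \<open>w v\<close>. Multiples in the monoid are written as sums of equal
  terms, as in \<open>S_weight\<close>.\<close>

definition monomial_weight :: "('v \<Rightarrow> 'm::comm_monoid_add) \<Rightarrow> ('v \<Rightarrow>\<^sub>0 nat) \<Rightarrow> 'm" where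
  "monomial_weight w m = (\<Sum>v\<in>Poly_Mapping.keys m. \<Sum>_<Poly_Mapping.lookup m v. w v)"

text \<open>The coefficients are fixed by the monomials, so identities between such series become
  identities between sets of monomials.\<close>

definition support_series ::
  "('v \<Rightarrow> 'm::comm_monoid_add) \<Rightarrow> ('v \<Rightarrow>\<^sub>0 nat) set \<Rightarrow> ('v, 'm \<Rightarrow>\<^sub>0 int) mfps" where
  "support_series w A = Abs_mfps (\<lambda>m. if m \<in> A then Poly_Mapping.single (monomial_weight w m) 1 else 0)"

lemma mcoeff_support_series:
  "mcoeff (support_series w A) m = (if m \<in> A then Poly_Mapping.single (monomial_weight w m) 1 else 0)"
  by (simp add: support_series_def Abs_mfps_inverse)

lemma monomial_weight_0 [simp]: "monomial_weight w 0 = 0"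
  by (simp add: monomial_weight_def)

lemma monomial_weight_single [simp]: "monomial_weight w (Poly_Mapping.single v (Suc 0)) = w v"
  by (simp add: monomial_weight_def)

lemma sum_const_add: "(\<Sum>_<p + q :: nat. c :: 'm::comm_monoid_add) = (\<Sum>_<p. c) + (\<Sum>_<q. c)"
  by (induction q) (simp_all add: add_ac)

lemma monomial_weight_add: "monomial_weight w (a + b) = monomial_weight w a + monomial_weight w b"
proof -
  let ?K = "Poly_Mapping.keys a \<union> Poly_Mapping.keys b"
  have *: "monomial_weight w m = (\<Sum>v\<in>?K. \<Sum>_<Poly_Mapping.lookup m v. w v)"
    if "Poly_Mapping.keys m \<subseteq> ?K" for m
    unfolding monomial_weight_def
    by (rule sum.mono_neutral_left) (use that in \<open>auto simp: in_keys_iff\<close>)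
  show ?thesis
    by (simp add: * Poly_Mapping.keys_add lookup_add sum_const_add sum.distrib)
qed

lemma support_series_0: "support_series w {0} = 1"
  by (rule mfps_eqI) (simp add: mcoeff_support_series one_mfps.rep_eq)

lemma support_series_Un:
  assumes "A \<inter> B = {}"
  shows "support_series w (A \<union> B) = support_series w A + support_series w B"
  by (rule mfps_eqI) (use assms in \<open>auto simp: mcoeff_support_series plus_mfps.rep_eq\<close>)

text \<open>Injectivity of addition means that each monomial of the product arises from a single
  pair, so no coefficients accumulate; the weights add up.\<close>

lemma support_series_mult:
  assumes "inj_on (\<lambda>(a, b). a + b) (A \<times> B)"
  shows "support_series w A * support_series w B = support_series w ((\<lambda>(a, b). a + b) ` (A \<times> B))"
proof (rule mfps_eqI)
  fix m
  let ?f = "\<lambda>(a, b). mcoeff (support_series w A) a * mcoeff (support_series w B) b"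
  have eq: "mcoeff (support_series w A * support_series w B) m = sum ?f ({(a, b). a + b = m} \<inter> A \<times> B)"
    unfolding mcoeff_mult
    by (rule sum.mono_neutral_right) (auto simp: finite_antidiagonal mcoeff_support_series split: if_splits)
  show "mcoeff (support_series w A * support_series w B) m =
      mcoeff (support_series w ((\<lambda>(a, b). a + b) ` (A \<times> B))) m"
  proof (cases "\<exists>a\<in>A. \<exists>b\<in>B. a + b = m")
    case True
    then obtain a b where ab: "a \<in> A" "b \<in> B" "a + b = m"
      by blast
    then have "{(a, b). a + b = m} \<inter> A \<times> B = {(a, b)}"
      using assms by (force simp: inj_on_def)
    moreover have "m \<in> (\<lambda>(a, b). a + b) ` (A \<times> B)"
      using ab by force
    ultimately show ?thesis
      using ab by (simp add: eq mcoeff_support_series mult_single flip: monomial_weight_add)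
  next
    case False
    then have "{(a, b). a + b = m} \<inter> A \<times> B = {}"
      by blast
    then show ?thesis
      using False by (auto simp: eq mcoeff_support_series)
  qed
qed

lemma support_series_singleton_mult:
  "support_series w {a} * support_series w {b} = support_series w {a + b}"
  by (subst support_series_mult) auto

lemma support_series_singleton_prod:
  "(\<Prod>k\<in>K. support_series w {a k}) = support_series w {\<Sum>k\<in>K. a k}"
  by (induction K rule: infinite_finite_induct)
    (simp_all add: support_series_0 support_series_singleton_mult)

text \<open>By disjointness at most one index contributes a given monomial; its coefficient is final
  once a finite partial sum includes that index.\<close>

lemma has_sum_support_series:
  assumes "disjoint_family_on N I"
  shows "((\<lambda>i. support_series w (N i)) has_sum support_series w (\<Union>i\<in>I. N i)) I"
  unfolding has_sum_def
proof (rule tendsto_mfpsI)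
  fix m
  show "eventually (\<lambda>Y. mcoeff (\<Sum>i\<in>Y. support_series w (N i)) m =
      mcoeff (support_series w (\<Union>i\<in>I. N i)) m) (finite_subsets_at_top I)"
  proof (cases "\<exists>i\<in>I. m \<in> N i")
    case True
    then obtain i where i: "i \<in> I" "m \<in> N i"
      by blast
    have "mcoeff (\<Sum>i\<in>Y. support_series w (N i)) m = mcoeff (support_series w (\<Union>i\<in>I. N i)) m"
      if Y: "finite Y" "{i} \<subseteq> Y" "Y \<subseteq> I" for Y
    proof -
      have "(\<Sum>j\<in>Y. mcoeff (support_series w (N j)) m) = (\<Sum>j\<in>{i}. mcoeff (support_series w (N j)) m)"
        by (rule sum.mono_neutral_right)
          (use Y i assms in \<open>auto simp: mcoeff_support_series disjoint_family_on_def\<close>)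
      then show ?thesis
        using i by (auto simp: mcoeff_sum mcoeff_support_series)
    qed
    then show ?thesis
      unfolding eventually_finite_subsets_at_top using i by (intro exI[of _ "{i}"]) auto
  next
    case False
    then have "mcoeff (\<Sum>i\<in>Y. support_series w (N i)) m = 0" if "Y \<subseteq> I" for Y
      using that by (auto simp: mcoeff_sum mcoeff_support_series intro!: sum.neutral)
    then show ?thesis
      unfolding eventually_finite_subsets_at_top
      using False by (intro exI[of _ "{}"]) (auto simp: mcoeff_support_series)
  qed
qed

text \<open>A monomial that has entered an increasing family stays in it, so every coefficient is
  eventually constant.\<close>

lemma tendsto_support_series:
  assumes "incseq A"
  shows "(\<lambda>n. support_series w (A n)) \<longlonglongrightarrow> support_series w (\<Union>n. A n)"
proof (rule tendsto_mfpsI)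
  fix m
  show "eventually (\<lambda>n. mcoeff (support_series w (A n)) m = mcoeff (support_series w (\<Union>n. A n)) m)
      sequentially"
  proof (cases "\<exists>n. m \<in> A n")
    case True
    then obtain n where n: "m \<in> A n" ..
    have "m \<in> A k" if "n \<le> k" for k
      using assms n that by (auto simp: incseq_def)
    then show ?thesis
      using n unfolding eventually_sequentially
      by (intro exI[of _ n]) (auto simp: mcoeff_support_series)
  qed (simp add: mcoeff_support_series)
qed

section \<open>Series in a single color\<close>

lemma color_mult_qpow:
  "color i * qpow (w i) = support_series w {Poly_Mapping.single i (Suc 0)}"
  by (rule mfps_eqI)
    (simp add: color_def qpow_def mcoeff_mult_const mcoeff_support_series mfps_var.rep_eq)

lemma one_plus_color_mult_qpow:
  "1 + color i * qpow (w i) = support_series w {0, Poly_Mapping.single i (Suc 0)}"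
proof -
  have "support_series w ({0} \<union> {Poly_Mapping.single i (Suc 0)}) = 1 + color i * qpow (w i)"
    by (subst support_series_Un)
      (auto simp: support_series_0 color_mult_qpow dest: arg_cong[of _ _ "\<lambda>m. Poly_Mapping.lookup m i"])
  then show ?thesis
    by (simp add: insert_commute)
qed

text \<open>This is the geometric series: every power of the indeterminate is trivial or the
  indeterminate times another power, so the series \<open>f\<close> of all powers satisfies
  \<open>f = 1 + x * f\<close>.\<close>

lemma inverse_one_minus_color_mult_qpow:
  "inverse (1 - color i * qpow (w i)) = support_series w (range (Poly_Mapping.single i))"
proof (rule mfps_inverse_eqI)
  let ?R = "range (Poly_Mapping.single i :: nat \<Rightarrow> _)"
  let ?x = "color i * qpow (w i)"
  let ?R' = "(\<lambda>(a, b). a + b) ` ({Poly_Mapping.single i (Suc 0)} \<times> ?R)"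
  have R: "?R = {0} \<union> ?R'"
  proof (intro equalityI subsetI)
    fix m assume "m \<in> ?R"
    then obtain n where n: "m = Poly_Mapping.single i n" ..
    show "m \<in> {0} \<union> ?R'"
    proof (cases n)
      case (Suc k)
      then have "m = (\<lambda>(a, b). a + b) (Poly_Mapping.single i (Suc 0), Poly_Mapping.single i k)"
        by (simp add: n flip: single_add)
      then show ?thesis
        by blast
    qed (simp add: n)
  next
    fix m assume "m \<in> {0} \<union> ?R'"
    then show "m \<in> ?R"
      by (auto simp flip: single_add) (metis rangeI single_zero)
  qed
  have "support_series w ({0} \<union> ?R') = support_series w {0} + support_series w ?R'"
    by (rule support_series_Un) (auto dest: arg_cong[of _ _ "\<lambda>m. Poly_Mapping.lookup m i"] simp: lookup_add)
  moreover have "support_series w ?R' = ?x * support_series w ?R"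
    unfolding color_mult_qpow by (rule support_series_mult[symmetric]) (auto simp: inj_on_def)
  ultimately have "support_series w ?R = 1 + ?x * support_series w ?R"
    by (simp only: R[symmetric] support_series_0)
  then show "(1 - ?x) * support_series w ?R = 1"
    by (simp add: left_diff_distrib diff_eq_eq add.commute)
qed

section \<open>Monomials of over-partitions\<close>

text \<open>Zeros are left out because an over-partition has infinitely many of them.\<close>

definition part_monomial :: "(nat \<Rightarrow> oint) \<Rightarrow> oint \<Rightarrow>\<^sub>0 nat" where
  "part_monomial u = (\<Sum>k\<in>{k. u k \<noteq> Plain 0}. Poly_Mapping.single (u k) 1)"

lemma lookup_part_monomial:
  assumes "u \<in> overpartitions"
  shows "Poly_Mapping.lookup (part_monomial u) x = (if x = Plain 0 then 0 else card {k. u k = x})"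
proof -
  have "Poly_Mapping.lookup (part_monomial u) x =
      (\<Sum>k\<in>{k. u k \<noteq> Plain 0}. if u k = x then 1 else 0)"
    by (simp add: part_monomial_def lookup_sum lookup_single when_def del: One_nat_def)
  also have "\<dots> = card {k \<in> {k. u k \<noteq> Plain 0}. u k = x}"
    using overpartition_finite[OF assms] by (simp add: sum.If_cases Int_def)
  also have "{k \<in> {k. u k \<noteq> Plain 0}. u k = x} = (if x = Plain 0 then {} else {k. u k = x})"
    by auto
  finally show ?thesis
    by auto
qed

lemma finite_fiber:
  assumes "u \<in> overpartitions" "x \<noteq> Plain 0"
  shows "finite {k. u k = x}"
  by (rule finite_subset[OF _ overpartition_finite[OF assms(1)]]) (use assms(2) in auto)

text \<open>The value \<open>v k\<close> can occur in \<open>u\<close> only before the index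
  \<open>k\<close>, where both sequences agree, whereas \<open>v\<close> has it at \<open>k\<close>
  as well. Its multiplicities therefore differ.\<close>

lemma part_monomial_less_aux:
  assumes "u \<in> overpartitions" "v \<in> overpartitions"
    and "\<And>j. j < k \<Longrightarrow> u j = v j" and "u k < v k"
  shows "part_monomial u \<noteq> part_monomial v"
proof -
  have nz: "v k \<noteq> Plain 0"
    using assms(4) Plain_0_le[of "u k"] by (metis leD)
  have "{j. u j = v k} \<subset> {j. v j = v k}"
  proof
    show "{j. u j = v k} \<subseteq> {j. v j = v k}"
    proof
      fix j assume j: "j \<in> {j. u j = v k}"
      then have "j < k"
        using assms(4) overpartition_decseq[OF assms(1), of k j] by (cases "j < k") auto
      then show "j \<in> {j. v j = v k}"
        using j assms(3) by simp
    qed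
    show "{j. u j = v k} \<noteq> {j. v j = v k}"
      using assms(4) by (metis (mono_tags) less_irrefl mem_Collect_eq)
  qed
  then have "card {j. u j = v k} < card {j. v j = v k}"
    by (rule psubset_card_mono[OF finite_fiber[OF assms(2) nz]])
  then show ?thesis
    using lookup_part_monomial[OF assms(1), of "v k"] lookup_part_monomial[OF assms(2), of "v k"] nz
    by auto
qed

text \<open>The chain is linear, so at the first index of disagreement
  \<open>part_monomial_less_aux\<close> applies in one of the two orders.\<close>

lemma inj_on_part_monomial: "inj_on part_monomial overpartitions"
proof (rule inj_onI, rule ccontr)
  fix u v assume uv: "u \<in> overpartitions" "v \<in> overpartitions" "part_monomial u = part_monomial v" "u \<noteq> v"
  define k where "k = (LEAST k. u k \<noteq> v k)"
  have "\<exists>k. u k \<noteq> v k"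
    using uv(4) by auto
  then have "u k \<noteq> v k"
    unfolding k_def by (rule LeastI_ex)
  moreover have eq: "u j = v j" if "j < k" for j
    using not_less_Least[of j "\<lambda>k. u k \<noteq> v k"] that by (auto simp: k_def)
  ultimately consider "u k < v k" | "v k < u k"
    by (meson linorder_neqE)
  then show False
  proof cases
    case 1
    then show False
      using part_monomial_less_aux[OF uv(1,2) eq] uv(3) by simp
  next
    case 2
    then show False
      using part_monomial_less_aux[OF uv(2,1) eq[symmetric]] uv(3) by simp
  qed
qed

text \<open>The prescribed parts are listed in non-increasing order and continued by zeros; the
  bound on the exponents makes over-lined parts unique.\<close>

lemma ex_overpartition:
  assumes "Poly_Mapping.lookup m (Plain 0) = 0" "\<And>j. Poly_Mapping.lookup m (Over j) \<le> 1"
  shows "\<exists>u\<in>overpartitions. part_monomial u = m"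
proof -
  define M where "M = (\<Sum>x\<in>Poly_Mapping.keys m. replicate_mset (Poly_Mapping.lookup m x) x)"
  have count_M: "count M x = Poly_Mapping.lookup m x" for x
    by (auto simp: M_def count_sum in_keys_iff sum.delta)
  define xs where "xs = rev (sorted_list_of_multiset M)"
  define u where "u k = (if k < length xs then xs ! k else Plain 0)" for k
  have mset_xs: "mset xs = M"
    by (simp add: xs_def)
  have nz: "xs ! k \<noteq> Plain 0" if "k < length xs" for k
    using that assms(1) count_M[of "Plain 0"] mset_xs
    by (metis count_eq_zero_iff nth_mem set_mset_mset)
  have card_fiber: "card {k. u k = x} = Poly_Mapping.lookup m x" if "x \<noteq> Plain 0" for x
  proof -
    have "{k. u k = x} = {k. k < length xs \<and> x = xs ! k}"
      using that by (auto simp: u_def)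
    then have "card {k. u k = x} = length (filter (\<lambda>y. x = y) xs)"
      by (simp add: length_filter_conv_card)
    also have "\<dots> = count (mset xs) x"
      by (simp add: count_mset count_list_eq_length_filter)
    finally show ?thesis
      by (simp add: mset_xs count_M)
  qed
  have "sorted (rev xs)"
    by (simp add: xs_def)
  then have "decseq u"
    unfolding decseq_def u_def by (auto simp: sorted_rev_nth_mono)
  moreover have fin: "finite {k. u k \<noteq> Plain 0}"
    by (rule finite_subset[of _ "{..<length xs}"]) (auto simp: u_def)
  moreover have "k = k'" if "u k = Over j" "u k' = Over j" for j k k'
  proof -
    have "finite {k. u k = Over j}"
      by (rule finite_subset[OF _ fin]) auto
    moreover have "card {k. u k = Over j} \<le> Suc 0"
      using card_fiber[of "Over j"] assms(2)[of j] by simp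
    ultimately show ?thesis
      using that card_le_Suc0_iff_eq by blast
  qed
  ultimately have u: "u \<in> overpartitions"
    unfolding overpartitions_def by blast
  have "part_monomial u = m"
    by (rule poly_mapping_eqI) (simp add: lookup_part_monomial[OF u] card_fiber assms(1))
  then show ?thesis
    using u by blast
qed

text \<open>
  The set \<open>L\<close> prescribes the admissible multiplicities of the pairs of parts \<open>Over k\<close> and
  \<open>Plain (k + 1)\<close>, which share the size \<open>k + 1\<close>.
\<close>

definition pair_exponents :: "(oint \<Rightarrow>\<^sub>0 nat) \<Rightarrow> nat \<Rightarrow> nat \<times> nat" where
  "pair_exponents m k = (Poly_Mapping.lookup m (Over k), Poly_Mapping.lookup m (Plain (Suc k)))"

definition pair_monomial :: "nat \<Rightarrow> nat \<times> nat \<Rightarrow> oint \<Rightarrow>\<^sub>0 nat" where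
  "pair_monomial k = (\<lambda>(a, b). Poly_Mapping.single (Over k) a + Poly_Mapping.single (Plain (Suc k)) b)"

text \<open>If \<open>(0, 0) \<in> L\<close>, these sets increase with \<open>n\<close> and serve as
  partial products. Otherwise \<open>n\<close> is determined by the monomial and the sets are
  disjoint.\<close>

definition bounded_monomials :: "(nat \<times> nat) set \<Rightarrow> nat \<Rightarrow> (oint \<Rightarrow>\<^sub>0 nat) set" where
  "bounded_monomials L n = {m. Poly_Mapping.lookup m (Plain 0) = 0 \<and>
     (\<forall>k. pair_exponents m k \<in> (if k < n then L else {(0, 0)}))}"

lemma pair_exponents_add: "pair_exponents (a + b) k = pair_exponents a k + pair_exponents b k"
  by (simp add: pair_exponents_def lookup_add)

lemma pair_exponents_pair_monomial: "pair_exponents (pair_monomial k p) j = (if j = k then p else (0, 0))"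
  by (cases p) (auto simp: pair_exponents_def pair_monomial_def lookup_add lookup_single)

lemma lookup_pair_monomial_0 [simp]: "Poly_Mapping.lookup (pair_monomial k p) (Plain 0) = 0"
  by (cases p) (auto simp: pair_monomial_def lookup_add lookup_single)

lemma monomial_eqI:
  assumes "Poly_Mapping.lookup a (Plain 0) = Poly_Mapping.lookup b (Plain 0)"
    and "\<And>k. pair_exponents a k = pair_exponents b k"
  shows "a = b"
proof (rule poly_mapping_eqI)
  fix x
  show "Poly_Mapping.lookup a x = Poly_Mapping.lookup b x"
  proof (cases x)
    case (Plain n)
    then show ?thesis
      using assms by (cases n) (auto simp: pair_exponents_def)
  qed (use assms in \<open>auto simp: pair_exponents_def\<close>)
qed

lemma bounded_monomials_0: "bounded_monomials L 0 = {0}"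
  by (auto simp: bounded_monomials_def intro!: monomial_eqI) (simp_all add: pair_exponents_def)

lemma bounded_monomials_Suc:
  "bounded_monomials L (Suc n) =
     (\<lambda>(a, b). a + b) ` (bounded_monomials L n \<times> pair_monomial n ` L)" (is "_ = ?R")
proof (intro equalityI subsetI)
  fix m assume m: "m \<in> bounded_monomials L (Suc n)"
  \<comment> \<open>\<open>?p\<close> is the factor of \<open>m\<close> in the two parts of size
    \<open>n + 1\<close>. Subtraction of exponents is truncated, so \<open>?p\<close> has to be seen
    to divide \<open>m\<close>.\<close>
  let ?p = "pair_monomial n (pair_exponents m n)"
  have eq: "(m - ?p) + ?p = m"
  proof (rule poly_mapping_eqI)
    fix x
    have "Poly_Mapping.lookup ?p x \<le> Poly_Mapping.lookup m x"
      by (cases x) (auto simp: pair_monomial_def pair_exponents_def lookup_add lookup_single when_def)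
    then show "Poly_Mapping.lookup (m - ?p + ?p) x = Poly_Mapping.lookup m x"
      by (simp add: lookup_add lookup_minus)
  qed
  have "pair_exponents (m - ?p) k = (if k = n then (0, 0) else pair_exponents m k)" for k
    by (auto simp: pair_monomial_def pair_exponents_def lookup_add lookup_minus lookup_single)
  then have "m - ?p \<in> bounded_monomials L n"
    using m by (auto simp: bounded_monomials_def lookup_minus split: if_splits)
      (metis less_SucE less_Suc_eq)+
  moreover have "pair_exponents m n \<in> L"
    using m by (auto simp: bounded_monomials_def dest: spec[of _ n])
  ultimately have "(m - ?p, ?p) \<in> bounded_monomials L n \<times> pair_monomial n ` L"
    by blast
  then have "(\<lambda>(a, b). a + b) (m - ?p, ?p) \<in> ?R"
    by (rule imageI)
  then show "m \<in> ?R"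
    by (simp add: eq)
next
  fix m assume "m \<in> ?R"
  then obtain a p where a: "a \<in> bounded_monomials L n" and p: "p \<in> L" and m: "m = a + pair_monomial n p"
    by auto
  have "pair_exponents m k \<in> (if k < Suc n then L else {(0, 0)})" for k
    using a p by (auto simp: m pair_exponents_add pair_exponents_pair_monomial bounded_monomials_def
        plus_prod_def less_Suc_eq dest!: spec[of _ k])
  then show "m \<in> bounded_monomials L (Suc n)"
    using a by (simp add: bounded_monomials_def m lookup_add)
qed

lemma support_series_bounded_monomials:
  "support_series w (bounded_monomials L n) = (\<Prod>k<n. support_series w (pair_monomial k ` L))"
proof (induction n)
  case (Suc n)
  have "inj_on (\<lambda>(a, b). a + b) (bounded_monomials L n \<times> pair_monomial n ` L)"
  proof (rule inj_onI, clarify)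
    fix a b p r p' r'
    assume a: "a \<in> bounded_monomials L n" "b \<in> bounded_monomials L n"
      and eq: "a + pair_monomial n (p, r) = b + pair_monomial n (p', r')"
    \<comment> \<open>The first summands have no parts of size \<open>n + 1\<close>, so the
      exponents there recover the second summands, and the first ones follow by
      cancellation.\<close>
    have "pair_exponents a n = (0, 0)" "pair_exponents b n = (0, 0)"
      using a by (auto simp: bounded_monomials_def dest!: spec[of _ n])
    then have "(p, r) = (p', r')"
      using arg_cong[OF eq, of "\<lambda>m. pair_exponents m n"]
      by (simp add: pair_exponents_add pair_exponents_pair_monomial plus_prod_def)
    then show "a = b \<and> pair_monomial n (p, r) = pair_monomial n (p', r')"
      using eq by simp
  qed
  then show ?case
    by (simp add: bounded_monomials_Suc Suc flip: support_series_mult)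
qed (simp add: bounded_monomials_0 support_series_0)

text \<open>This splits a factor into its numerator, coming from the over-lined part, and its
  denominator, coming from the plain part.\<close>

lemma support_series_pair_monomials:
  "support_series w (pair_monomial k ` (A \<times> B)) =
     support_series w (Poly_Mapping.single (Over k) ` A) *
     support_series w (Poly_Mapping.single (Plain (Suc k)) ` B)"
proof -
  have "inj_on (\<lambda>(a, b). a + b)
      (Poly_Mapping.single (Over k) ` A \<times> Poly_Mapping.single (Plain (Suc k)) ` B)"
  proof (rule inj_onI, clarify)
    fix a b a' b' :: nat
    assume "Poly_Mapping.single (Over k) a + Poly_Mapping.single (Plain (Suc k)) b =
      Poly_Mapping.single (Over k) a' + Poly_Mapping.single (Plain (Suc k)) b'"
    then have "pair_monomial k (a, b) = pair_monomial k (a', b')"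
      by (simp add: pair_monomial_def)
    then have "(a, b) = (a', b')"
      using pair_exponents_pair_monomial[of k _ k] by metis
    then show "Poly_Mapping.single (Over k) a = Poly_Mapping.single (Over k) a' \<and>
        Poly_Mapping.single (Plain (Suc k)) b = Poly_Mapping.single (Plain (Suc k)) b'"
      by simp
  qed
  moreover have "(\<lambda>(a, b). a + b) `
      (Poly_Mapping.single (Over k) ` A \<times> Poly_Mapping.single (Plain (Suc k)) ` B) =
      pair_monomial k ` (A \<times> B)"
    by (force simp: pair_monomial_def image_iff)
  ultimately show ?thesis
    by (simp add: support_series_mult)
qed

section \<open>Infinite products as limits of bounded monomials\<close>

definition all_monomials :: "(nat \<times> nat) set \<Rightarrow> (oint \<Rightarrow>\<^sub>0 nat) set" where
  "all_monomials L = {m. Poly_Mapping.lookup m (Plain 0) = 0 \<and> (\<forall>k. pair_exponents m k \<in> L)}"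

lemma all_monomials_mono: "L \<subseteq> L' \<Longrightarrow> all_monomials L \<subseteq> all_monomials L'"
  unfolding all_monomials_def by blast

lemma bounded_monomials_subset: "bounded_monomials L n \<subseteq> all_monomials (insert (0, 0) L)"
proof
  fix m assume m: "m \<in> bounded_monomials L n"
  then have "pair_exponents m k \<in> (if k < n then L else {(0, 0)})" for k
    by (simp add: bounded_monomials_def)
  then have "pair_exponents m k \<in> insert (0, 0) L" for k
    by (metis insertCI singletonD)
  then show "m \<in> all_monomials (insert (0, 0) L)"
    using m by (simp add: bounded_monomials_def all_monomials_def)
qed

lemma pair_exponents_eventually_0: "\<exists>n. \<forall>k\<ge>n. pair_exponents m k = (0, 0)"
proof -
  \<comment> \<open>Inserting \<open>0\<close> keeps the maximum meaningful for the trivial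
    monomial.\<close>
  define n where "n = Suc (Max (insert 0 (osize ` Poly_Mapping.keys m)))"
  have "Poly_Mapping.lookup m x = 0" if "n \<le> osize x" for x
  proof (rule ccontr)
    assume "Poly_Mapping.lookup m x \<noteq> 0"
    then have "osize x \<le> Max (insert 0 (osize ` Poly_Mapping.keys m))"
      by (intro Max_ge) (auto simp: in_keys_iff)
    then show False
      using that by (simp add: n_def)
  qed
  then show ?thesis
    by (auto simp: pair_exponents_def intro!: exI[of _ n])
qed

lemma Union_bounded_monomials:
  assumes "(0, 0) \<in> L"
  shows "(\<Union>n. bounded_monomials L n) = all_monomials L"
proof (intro equalityI subsetI)
  fix m assume m: "m \<in> all_monomials L"
  obtain n where "\<forall>k\<ge>n. pair_exponents m k = (0, 0)"
    using pair_exponents_eventually_0 by blast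
  then have "m \<in> bounded_monomials L n"
    using m by (auto simp: bounded_monomials_def all_monomials_def)
  then show "m \<in> (\<Union>n. bounded_monomials L n)"
    by blast
next
  fix m assume "m \<in> (\<Union>n. bounded_monomials L n)"
  then show "m \<in> all_monomials L"
    using bounded_monomials_subset[of L] by (auto simp: insert_absorb[OF assms])
qed

lemma incseq_bounded_monomials:
  assumes "(0, 0) \<in> L"
  shows "incseq (bounded_monomials L)"
  unfolding incseq_def
proof (intro allI impI subsetI)
  fix n n' m assume n: "n \<le> n'" and m: "m \<in> bounded_monomials L n"
  have "pair_exponents m k \<in> (if k < n then L else {(0, 0)})" for k
    using m by (simp add: bounded_monomials_def)
  then have "pair_exponents m k \<in> (if k < n' then L else {(0, 0)})" for k
    using n assms by (metis less_le_trans singletonD)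
  then show "m \<in> bounded_monomials L n'"
    using m by (simp add: bounded_monomials_def)
qed

lemma has_prod_support_series:
  assumes "(0, 0) \<in> L"
  shows "(\<lambda>k. support_series w (pair_monomial k ` L)) has_prod support_series w (all_monomials L)"
proof -
  let ?P = "\<lambda>n. \<Prod>k<n. support_series w (pair_monomial k ` L)"
  have "?P \<longlonglongrightarrow> support_series w (all_monomials L)"
    using tendsto_support_series[OF incseq_bounded_monomials[OF assms], of w]
    by (simp add: Union_bounded_monomials[OF assms] support_series_bounded_monomials)
  then have "(\<lambda>n. ?P (Suc n)) \<longlonglongrightarrow> support_series w (all_monomials L)"
    by (rule LIMSEQ_Suc)
  \<comment> \<open>\<open>has_prod\<close> also asks for a non-zero limit; the coefficient of the
    trivial monomial witnesses this.\<close>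
  moreover have "0 \<in> all_monomials L"
    using assms by (simp add: all_monomials_def pair_exponents_def)
  then have "mcoeff (support_series w (all_monomials L)) 0 \<noteq> mcoeff 0 0"
    by (simp add: mcoeff_support_series zero_mfps.rep_eq)
  then have "support_series w (all_monomials L) \<noteq> 0"
    by metis
  ultimately show ?thesis
    by (simp add: has_prod_def raw_has_prod_def lessThan_Suc_atMost)
qed

section \<open>Monomials of the classes of over-partitions\<close>

lemma overpartition_monomials:
  "part_monomial ` overpartitions = all_monomials ({0, 1} \<times> UNIV)"
proof (intro equalityI subsetI)
  fix m assume "m \<in> part_monomial ` overpartitions"
  then obtain u where u: "u \<in> overpartitions" and m: "m = part_monomial u"
    by blast
  have "card {k. u k = Over j} \<le> Suc 0" for j
    using card_le_Suc0_iff_eq[OF finite_fiber[OF u, of "Over j"]] overpartition_Over_unique[OF u]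
    by auto
  then have "card {k. u k = Over j} = 0 \<or> card {k. u k = Over j} = Suc 0" for j
    by (metis le_Suc_eq le_zero_eq)
  then show "m \<in> all_monomials ({0, 1} \<times> UNIV)"
    by (auto simp: all_monomials_def pair_exponents_def m lookup_part_monomial[OF u])
next
  fix m assume "m \<in> all_monomials ({0, 1} \<times> UNIV)"
  then have "Poly_Mapping.lookup m (Plain 0) = 0" "Poly_Mapping.lookup m (Over j) \<le> 1" for j
    by (auto simp: all_monomials_def pair_exponents_def dest!: spec[of _ j])
  then show "m \<in> part_monomial ` overpartitions"
    using ex_overpartition[of m] by blast
qed

lemma lookup_part_monomial_eq_0_iff:
  assumes "u \<in> overpartitions" "x \<noteq> Plain 0"
  shows "Poly_Mapping.lookup (part_monomial u) x = 0 \<longleftrightarrow> x \<notin> range u"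
  using assms finite_fiber[OF assms] by (auto simp: lookup_part_monomial)

text \<open>Every monomial of \<open>A\<close> already comes from some over-partition, so describing
  a class reduces to a membership test.\<close>

lemma part_monomial_image:
  assumes "E \<subseteq> overpartitions" "A \<subseteq> all_monomials ({0, 1} \<times> UNIV)"
    and "\<And>u. u \<in> overpartitions \<Longrightarrow> u \<in> E \<longleftrightarrow> part_monomial u \<in> A"
  shows "part_monomial ` E = A"
proof (intro equalityI subsetI)
  fix m assume m: "m \<in> A"
  then have "m \<in> part_monomial ` overpartitions"
    using assms(2) by (auto simp: overpartition_monomials)
  then obtain u where "u \<in> overpartitions" "m = part_monomial u"
    by blast
  then show "m \<in> part_monomial ` E"
    using assms(3) m by blast
next
  fix m assume "m \<in> part_monomial ` E"
  then obtain u where "u \<in> E" "m = part_monomial u"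
    by blast
  then show "m \<in> A"
    using assms(1,3) by blast
qed

lemma partition_monomials: "part_monomial ` partitions = all_monomials ({0} \<times> UNIV)"
proof (rule part_monomial_image[OF _ all_monomials_mono])
  fix u assume u: "u \<in> overpartitions"
  have "u \<in> partitions \<longleftrightarrow> (\<forall>k. Over k \<notin> range u)"
    using u by (auto simp: partitions_def overlined_iff image_iff; metis)
  then show "u \<in> partitions \<longleftrightarrow> part_monomial u \<in> all_monomials ({0} \<times> UNIV)"
    by (simp add: all_monomials_def pair_exponents_def lookup_part_monomial_eq_0_iff[OF u])
      (simp add: lookup_part_monomial[OF u])
qed (auto simp: partitions_def)

lemma overlined_partition_monomials:
  "part_monomial ` overlined_partitions = all_monomials ({0, 1} \<times> {0})"
proof (rule part_monomial_image[OF _ all_monomials_mono])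
  fix u assume u: "u \<in> overpartitions"
  have "(y \<noteq> Plain 0 \<longrightarrow> overlined y) \<longleftrightarrow> (\<forall>k. y \<noteq> Plain (Suc k))" for y
  proof (cases y)
    case (Plain n)
    then show ?thesis
      by (cases n) auto
  qed auto
  then have "u \<in> overlined_partitions \<longleftrightarrow> (\<forall>j k. u j \<noteq> Plain (Suc k))"
    using u unfolding overlined_partitions_def Plain_0_less_iff by simp
  also have "\<dots> \<longleftrightarrow> (\<forall>k. Plain (Suc k) \<notin> range u)"
    unfolding image_iff by (metis UNIV_I)
  \<comment> \<open>That over-lined exponents are at most one is inherited from the description of
    all over-partitions.\<close>
  finally show "u \<in> overlined_partitions \<longleftrightarrow> part_monomial u \<in> all_monomials ({0, 1} \<times> {0})"
    using imageI[OF u, of part_monomial] unfolding overpartition_monomials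
    by (auto simp: all_monomials_def pair_exponents_def lookup_part_monomial_eq_0_iff[OF u])
qed (auto simp: overlined_partitions_def)

text \<open>The cut \<open>n\<close> is the size of the largest part: up to it every over-lined
  integer occurs exactly once and the plain ones are free, beyond it nothing occurs.\<close>

lemma full_overpartition_monomials:
  "part_monomial ` full_overpartitions = (\<Union>n. bounded_monomials ({1} \<times> UNIV) n)"
proof (rule part_monomial_image)
  fix u assume u: "u \<in> overpartitions"
  let ?m = "part_monomial u"
  have m: "?m \<in> all_monomials ({0, 1} \<times> UNIV)"
    using u overpartition_monomials by blast
  show "u \<in> full_overpartitions \<longleftrightarrow> ?m \<in> (\<Union>n. bounded_monomials ({1} \<times> UNIV) n)"
  proof
    assume full: "u \<in> full_overpartitions"
    define n where "n = osize (u 0)"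
    have "Over k \<in> range u" if "k < n" for k
      using full that by (simp add: full_overpartitions_def Over_le_iff n_def)
    then have "Poly_Mapping.lookup ?m (Over k) \<noteq> 0" if "k < n" for k
      using that by (simp add: lookup_part_monomial_eq_0_iff[OF u])
    moreover have "Poly_Mapping.lookup ?m (Over k) \<in> {0, 1}" for k
      using m by (auto simp: all_monomials_def pair_exponents_def dest!: spec[of _ k])
    ultimately have less: "Poly_Mapping.lookup ?m (Over k) = 1" if "k < n" for k
      using that by blast
    have "Over k \<notin> range u \<and> Plain (Suc k) \<notin> range u" if "\<not> k < n" for k
    proof -
      have "\<not> Over k \<le> u i" for i
        using that overpartition_decseq[OF u, of 0 i] by (auto simp: n_def simp flip: Over_le_iff)
      then show ?thesis
        by (auto simp: Over_le_iff) (metis lessI osize.simps)+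
    qed
    then have "pair_exponents ?m k = (0, 0)" if "\<not> k < n" for k
      using that by (simp add: pair_exponents_def lookup_part_monomial_eq_0_iff[OF u])
    then have "?m \<in> bounded_monomials ({1} \<times> UNIV) n"
      using less m by (auto simp: bounded_monomials_def all_monomials_def pair_exponents_def)
    then show "?m \<in> (\<Union>n. bounded_monomials ({1} \<times> UNIV) n)"
      by blast
  next
    assume "?m \<in> (\<Union>n. bounded_monomials ({1} \<times> UNIV) n)"
    then obtain n where n: "pair_exponents ?m k \<in> (if k < n then {1} \<times> UNIV else {(0, 0)})" for k
      unfolding bounded_monomials_def by blast
    have range: "Over k \<in> range u \<longleftrightarrow> k < n" "Plain (Suc k) \<in> range u \<Longrightarrow> k < n" for k
      using n[of k] lookup_part_monomial_eq_0_iff[OF u, of "Over k"]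
        lookup_part_monomial_eq_0_iff[OF u, of "Plain (Suc k)"]
      by (auto simp: pair_exponents_def split: if_splits)
    \<comment> \<open>No part is larger than the cut, so the over-lined integers below
      \<open>u 0\<close> are among those that occur.\<close>
    have "osize (u 0) \<le> n"
    proof (cases "u 0")
      case (Plain p)
      then show ?thesis
        using range(2)[of "p - 1"] rangeI[of u 0] by (cases p) auto
    next
      case (Over p)
      then show ?thesis
        using range(1)[of p] rangeI[of u 0] by auto
    qed
    then show "u \<in> full_overpartitions"
      using u by (simp add: full_overpartitions_def range Over_le_iff)
  qed
next
  have "all_monomials (insert (0, 0) ({1} \<times> UNIV)) \<subseteq> all_monomials ({0, 1} \<times> UNIV)"
    by (rule all_monomials_mono) auto
  then show "(\<Union>n. bounded_monomials ({1} \<times> UNIV) n) \<subseteq> all_monomials ({0, 1} \<times> UNIV)"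
    using bounded_monomials_subset by blast
qed (auto simp: full_overpartitions_def)

text \<open>The bound can be read off: the pair \<open>k\<close> is non-zero exactly for
  \<open>k < n\<close>.\<close>

lemma disjoint_bounded_monomials:
  assumes "(0, 0) \<notin> L"
  shows "disjoint_family (bounded_monomials L)"
proof -
  have "n = n'" if "m \<in> bounded_monomials L n" "m \<in> bounded_monomials L n'" for m n n'
  proof -
    have "k < n \<longleftrightarrow> pair_exponents m k \<noteq> (0, 0)" "k < n' \<longleftrightarrow> pair_exponents m k \<noteq> (0, 0)" for k
      using that assms by (auto simp: bounded_monomials_def dest!: spec[of _ k] split: if_splits)
    then have "k < n \<longleftrightarrow> k < n'" for k
      by simp
    then show ?thesis
      by (metis linorder_neqE_nat less_irrefl)
  qed
  then show ?thesis
    by (auto simp: disjoint_family_on_def)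
qed

section \<open>Generating functions\<close>

lemma qpow_sum: "finite K \<Longrightarrow> qpow (\<Sum>k\<in>K. f k) = (\<Prod>k\<in>K. qpow (f k))"
proof (induction K rule: finite_induct)
  case empty
  show ?case
    by (rule mfps_eqI) (simp add: qpow_def mfps_const.rep_eq one_mfps.rep_eq)
next
  case (insert k K)
  have "qpow (a + b) = qpow a * qpow b" for a b :: 'b
    by (rule mfps_eqI) (simp add: qpow_def mcoeff_mult_const mfps_const.rep_eq mult_single)
  then show ?case
    using insert by simp
qed

text \<open>Colors and weight are a product and a sum over the same non-zero terms of the conjugate,
  so they merge into one product of weighted colors.\<close>

lemma overpartition_term:
  assumes l: "l \<in> overpartitions"
  shows "C_overpartition l * qpow (S_weight s l) =
    support_series (S_sum s) {part_monomial (conjugate l)}"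
proof -
  have "finite {k. conjugate l k \<noteq> Plain 0}"
    using overpartition_finite conjugate_overpartition l by blast
  then show ?thesis
    by (simp add: C_overpartition_conjugate S_weight_conjugate l qpow_sum part_monomial_def
        color_mult_qpow support_series_singleton_prod flip: prod.distrib)
qed

text \<open>Conjugation and \<open>part_monomial\<close> are injective, so distinct over-partitions
  contribute distinct monomials.\<close>

lemma has_sum_overpartitions:
  assumes E: "E \<subseteq> overpartitions" and bij: "bij_betw conjugate E E'"
  shows "((\<lambda>l. C_overpartition l * qpow (S_weight s l)) has_sum
    support_series (S_sum s) (part_monomial ` E')) E"
proof -
  have "inj_on (\<lambda>l. part_monomial (conjugate l)) E"
    using comp_inj_on[OF bij_betw_imp_inj_on[OF bij] inj_on_subset[OF inj_on_part_monomial]]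
      E conjugate_overpartition by (force simp: comp_def)
  then have "disjoint_family_on (\<lambda>l. {part_monomial (conjugate l)}) E"
    by (auto simp: disjoint_family_on_def inj_on_def)
  from has_sum_support_series[OF this, of "S_sum s"]
  have "((\<lambda>l. support_series (S_sum s) {part_monomial (conjugate l)}) has_sum
      support_series (S_sum s) (part_monomial ` conjugate ` E)) E"
    by (simp add: UNION_singleton_eq_range image_image)
  then show ?thesis
    unfolding bij_betw_imp_surj_on[OF bij]
    by (rule iffD1[OF has_sum_cong, rotated]) (use E in \<open>auto simp: overpartition_term\<close>)
qed

section \<open>Factors of the product formulas\<close>

lemma bar_Suc [simp]: "bar (Suc k) = Over k"
  by (simp add: bar_def)

lemma S_sum_Plain_Suc: "S_sum s (Plain (Suc k)) = S_sum s (Over k)"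
  by (simp add: S_sum_altdef)

lemma inverse_color_factor:
  "inverse (1 - color (Plain k) * qpow (S_sum s (Plain k))) =
     support_series (S_sum s) (range (Poly_Mapping.single (Plain k)))"
  by (rule inverse_one_minus_color_mult_qpow)

lemma overpartition_factor:
  "(1 + color (bar (k + 1)) * qpow (S_sum s (Plain (k + 1)))) /
     (1 - color (Plain (k + 1)) * qpow (S_sum s (Plain (k + 1)))) =
   support_series (S_sum s) (pair_monomial k ` ({0, 1} \<times> UNIV))"
  unfolding support_series_pair_monomials divide_mfps_def inverse_color_factor
  by (simp add: S_sum_Plain_Suc one_plus_color_mult_qpow)

lemma partition_factor:
  "1 / (1 - color (Plain (k + 1)) * qpow (S_sum s (Plain (k + 1)))) =
   support_series (S_sum s) (pair_monomial k ` ({0} \<times> UNIV))"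
  unfolding support_series_pair_monomials divide_mfps_def inverse_color_factor
  by (simp add: support_series_0)

lemma overlined_factor:
  "1 + color (bar (k + 1)) * qpow (S_sum s (Plain (k + 1))) =
   support_series (S_sum s) (pair_monomial k ` ({0, 1} \<times> {0}))"
  unfolding support_series_pair_monomials
  by (simp add: support_series_0 S_sum_Plain_Suc one_plus_color_mult_qpow)

lemma full_factor:
  "color (bar (k + 1)) * qpow (S_sum s (Plain (k + 1))) /
     (1 - color (Plain (k + 1)) * qpow (S_sum s (Plain (k + 1)))) =
   support_series (S_sum s) (pair_monomial k ` ({1} \<times> UNIV))"
  unfolding support_series_pair_monomials divide_mfps_def inverse_color_factor
  by (simp add: S_sum_Plain_Suc color_mult_qpow)

text \<open>The index \<open>i\<close> collects the over-partitions whose largest part has size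
  \<open>i - 1\<close>, so that the factors run over \<open>1 \<le> j < i\<close>.\<close>

lemma has_sum_full:
  "((\<lambda>i. \<Prod>j\<in>{1..<i}. color (bar j) * qpow (S_sum s (Plain j)) /
        (1 - color (Plain j) * qpow (S_sum s (Plain j)))) has_sum
    support_series (S_sum s) (part_monomial ` full_overpartitions)) {1..}"
proof -
  let ?L = "{1} \<times> UNIV :: (nat \<times> nat) set"
  have "inj_on (\<lambda>i::nat. i - 1) {1..}"
    by (auto simp: inj_on_def)
  moreover have "disjoint_family (bounded_monomials ?L)"
    by (rule disjoint_bounded_monomials) simp
  ultimately have "disjoint_family_on (\<lambda>i. bounded_monomials ?L (i - 1)) {1..}"
    unfolding disjoint_family_on_def inj_on_def by blast
  note sums = has_sum_support_series[OF this, of "S_sum s"]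
  have union: "(\<Union>i\<in>{1..}. bounded_monomials ?L (i - 1)) = (\<Union>n. bounded_monomials ?L n)"
    by (auto intro!: bexI[of _ "Suc _"])
  have factors: "support_series (S_sum s) (bounded_monomials ?L (i - 1)) =
      (\<Prod>j\<in>{1..<i}. color (bar j) * qpow (S_sum s (Plain j)) /
        (1 - color (Plain j) * qpow (S_sum s (Plain j))))" if "i \<in> {1..}" for i
    unfolding support_series_bounded_monomials full_factor[symmetric]
    by (rule prod.reindex_bij_witness[of _ "\<lambda>j. j - 1" Suc]) (use that in auto)
  show ?thesis
    unfolding full_overpartition_monomials union[symmetric]
    by (rule iffD1[OF has_sum_cong[OF factors] sums])
qed

theorem theorem1p11:
  fixes s :: "nat \<Rightarrow> 'm::comm_monoid_add"
  shows "(\<forall>l\<in>overpartitions. colored_size (Phi s l) = S_weight s l \<and>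
           C_colored (Phi s l) = C_overpartition l) \<and>
    (bij_betw (Phi s) overpartitions (colored_sequences s overpartitions)) \<and>
    (bij_betw (Phi s) partitions (colored_sequences s partitions)) \<and>
    (bij_betw (Phi s) full_overpartitions (colored_sequences s overlined_partitions)) \<and>
    (bij_betw (Phi s) overlined_partitions (colored_sequences s full_overpartitions)) \<and>
    ((\<lambda>l. C_overpartition l * qpow (S_weight s l)) summable_on overpartitions) \<and>
    ((\<lambda>k. (1 + color (bar (k + 1)) * qpow (S_sum s (Plain (k + 1)))) /
              (1 - color (Plain (k + 1)) * qpow (S_sum s (Plain (k + 1)))))
         has_prod (\<Sum>\<^sub>\<infinity>l\<in>overpartitions. C_overpartition l * qpow (S_weight s l))) \<and>
    ((\<lambda>l. C_overpartition l * qpow (S_weight s l)) summable_on partitions) \<and>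
    ((\<lambda>k. 1 / (1 - color (Plain (k + 1)) * qpow (S_sum s (Plain (k + 1)))))
         has_prod (\<Sum>\<^sub>\<infinity>l\<in>partitions. C_overpartition l * qpow (S_weight s l))) \<and>
    ((\<lambda>l. C_overpartition l * qpow (S_weight s l)) summable_on full_overpartitions) \<and>
    ((\<lambda>k. 1 + color (bar (k + 1)) * qpow (S_sum s (Plain (k + 1))))
         has_prod (\<Sum>\<^sub>\<infinity>l\<in>full_overpartitions. C_overpartition l * qpow (S_weight s l))) \<and>
    ((\<lambda>l. C_overpartition l * qpow (S_weight s l)) summable_on overlined_partitions) \<and>
    ((\<lambda>i. \<Prod>j\<in>{1..<i}. color (bar j) * qpow (S_sum s (Plain j)) /
                (1 - color (Plain j) * qpow (S_sum s (Plain j)))) summable_on {1..}) \<and>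
    ((\<Sum>\<^sub>\<infinity>l\<in>overlined_partitions. C_overpartition l * qpow (S_weight s l)) =
         (\<Sum>\<^sub>\<infinity>i\<in>{1..}. \<Prod>j\<in>{1..<i}. color (bar j) * qpow (S_sum s (Plain j)) /
                (1 - color (Plain j) * qpow (S_sum s (Plain j)))))"
proof -
  have sub: "partitions \<subseteq> overpartitions" "full_overpartitions \<subseteq> overpartitions"
    "overlined_partitions \<subseteq> overpartitions"
    by (auto simp: partitions_def full_overpartitions_def overlined_partitions_def)
  have bij: "bij_betw conjugate overpartitions overpartitions"
    "bij_betw conjugate partitions partitions"
    "bij_betw conjugate full_overpartitions overlined_partitions"
    "bij_betw conjugate overlined_partitions full_overpartitions"
    by (rule bij_betw_conjugate;
        simp add: sub conjugate_overpartition conjugate_partition_iff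
          conjugate_overlined_iff_full conjugate_full_iff_overlined)+
  note sums = has_sum_overpartitions[OF order_refl bij(1), of s]
    has_sum_overpartitions[OF sub(1) bij(2), of s]
    has_sum_overpartitions[OF sub(2) bij(3), of s]
    has_sum_overpartitions[OF sub(3) bij(4), of s]
  show ?thesis
    unfolding infsumI[OF sums(1)] infsumI[OF sums(2)] infsumI[OF sums(3)] infsumI[OF sums(4)]
      infsumI[OF has_sum_full]
    \<comment> \<open>The quotients are rewritten first, since their numerators also match
      \<open>overlined_factor\<close>.\<close>
    unfolding overpartition_factor
    unfolding partition_factor overlined_factor
      overpartition_monomials partition_monomials overlined_partition_monomials
    by (intro conjI ballI colored_size_Phi C_colored_Phi bij_betw_Phi bij has_prod_support_series
        has_sum_imp_summable[OF sums(1)] has_sum_imp_summable[OF sums(2)]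
        has_sum_imp_summable[OF sums(3)] has_sum_imp_summable[OF sums(4)]
        has_sum_imp_summable[OF has_sum_full] refl) auto
qed

end
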